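(* Let $\mathbf{A}\mathbf{X}\mathbf{B}=\mathbf{C}$ be a two-sided matrix equation, where $\mathbf{A}\in\mathbf{H}^{m\times m}$, $\mathbf{B}\in\mathbf{H}^{n\times n}$, $\mathbf{C}\in\mathbf{H}^{m\times n}$ are given, $\mathbf{X}=(x_{ij})\in\mathbf{H}^{m\times n}$ is unknown, and $\mathbf{A}$, $\mathbf{B}$ are Hermitian. If $\det\mathbf{A}\neq0$ and $\det\mathbf{B}\neq 0$, then the unique solution of the equation can be represented, for all $i=1,\dots,m$ and $j=1,\dots,n$, as $$x_{ij}=\frac{\mathrm{rdet}_j\,\mathbf{B}_{j.}\left(\mathbf{c}^{\mathbf{A}}_{i.}\right)}{\det\mathbf{A}\cdot\det\mathbf{B}},\qquad\text{or}\qquad x_{ij}=\frac{\mathrm{cdet}_i\,\mathbf{A}_{.i}\left(\mathbf{c}^{\mathbf{B}}_{.j}\right)}{\det\mathbf{A}\cdot\det\mathbf{B}},$$ where $\mathbf{c}^{\mathbf{A}}_{i.}:=\left(\mathrm{cdet}_i\,\mathbf{A}_{.i}(\mathbf{c}_{.1}),\ldots,\mathrm{cdet}_i\,\mathbf{A}_{.i}(\mathbf{c}_{.n})\right)\in\mathbf{H}^{1\times n}$ is a row-vector, $\mathbf{c}^{\mathbf{B}}_{.j}:=\left(\mathrm{rdet}_j\,\mathbf{B}_{j.}(\mathbf{c}_{1.}),\ldots,\mathrm{rdet}_j\,\mathbf{B}_{j.}(\mathbf{c}_{m.})\right)^T\in\mathbf{H}^{m\times 1}$ is a column-vector, and $\mathbf{c}_{i.}$,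 $\mathbf{c}_{.j}$ are the $i$-th row and the $j$-th column of $\mathbf{C}$.
   Context: $\mathbf{H}$ denotes the coquaternions (split quaternions): the associative real algebra with basis $1,i,j,k$ and $i^2=-1$, $j^2=k^2=1$, $ij=-ji=k$, $jk=-kj=-i$, $ik=-ki=-j$. The conjugate of $q=q_0+q_1i+q_2j+q_3k$ is $\overline{q}=q_0-q_1i-q_2j-q_3k$. $\mathbf{A}^*=(\overline{a_{ji}})$ is the conjugate transpose of $\mathbf{A}=(a_{ij})$, and a square matrix $\mathbf{A}$ is Hermitian if $\mathbf{A}^*=\mathbf{A}$. Row and column determinants of $\mathbf{A}\in\mathbf{H}^{n\times n}$. For a cycle $\gamma$ (possibly a fixed point) of a permutation and an element $s$ of $\gamma$, put $a_\gamma^{(s)}=a_{s\,\gamma(s)}\,a_{\gamma(s)\,\gamma^2(s)}\cdots a_{\gamma^{-1}(s)\,s}$ (equal to $a_{ss}$ for a fixed point). Given an index $i$, write $\sigma\in S_n$ as a product of its $r$ disjoint cycles (fixed points included) $\gamma_1,\dots,\gamma_r$, where $\gamma_1$ contains $i$ and the minimal elements $m_t$ of $\gamma_t$ satisfy $m_2<m_3<\dots<m_r$. Then $\mathrm{rdet}_i\,\mathbf{A}=\sum_{\sigma\in S_n}(-1)^{n-r}a_{\gamma_1}^{(i)}a_{\gamma_2}^{(m_2)}\cdots a_{\gamma_r}^{(m_r)}$ and $\mathrm{cdet}_i\,\mathbf{A}=\sum_{\sigma\in S_n}(-1)^{n-r}a_{\gamma_r}^{(m_r)}\cdots a_{\gamma_2}^{(m_2)}a_{\gamma_1}^{(i)}$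 (factors multiplied in the order written). For Hermitian $\mathbf{A}$ it is known that all $\mathrm{rdet}_i\,\mathbf{A}$ and $\mathrm{cdet}_i\,\mathbf{A}$ coincide and are real; the common value is denoted $\det\mathbf{A}$. $\mathbf{A}_{.i}(\mathbf{c})$ (resp. $\mathbf{B}_{j.}(\mathbf{c})$) is the matrix obtained by replacing the $i$-th column of $\mathbf{A}$ (resp. the $j$-th row of $\mathbf{B}$) with the vector $\mathbf{c}$. *)

theory Defs
  imports
    "Jordan_Normal_Form.Determinant"
    "HOL-Combinatorics.Orbits"
begin

section \<open>Coquaternions\<close>

text \<open>\<open>Coquat a b c d\<close> stands for \<open>a + b i + c j + d k\<close>.\<close>

datatype coquat = Coquat (cq0: real) (cq1: real) (cq2: real) (cq3: real)

instantiation coquat :: real_algebra_1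
begin

definition zero_coquat :: coquat where
  "0 = Coquat 0 0 0 0"

definition one_coquat :: coquat where
  "1 = Coquat 1 0 0 0"

definition plus_coquat :: "coquat \<Rightarrow> coquat \<Rightarrow> coquat" where
  "p + q = Coquat (cq0 p + cq0 q) (cq1 p + cq1 q) (cq2 p + cq2 q) (cq3 p + cq3 q)"

definition uminus_coquat :: "coquat \<Rightarrow> coquat" where
  "- q = Coquat (- cq0 q) (- cq1 q) (- cq2 q) (- cq3 q)"

definition minus_coquat :: "coquat \<Rightarrow> coquat \<Rightarrow> coquat" where
  "p - q = Coquat (cq0 p - cq0 q) (cq1 p - cq1 q) (cq2 p - cq2 q) (cq3 p - cq3 q)"

definition scaleR_coquat :: "real \<Rightarrow> coquat \<Rightarrow> coquat" where
  "r *\<^sub>R q = Coquat (r * cq0 q) (r * cq1 q) (r * cq2 q) (r * cq3 q)"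

text \<open>The bilinear extension of the multiplication table of \<open>1, i, j, k\<close>; the table itself is
  the lemma \<open>coquat_basis_mult\<close> below.\<close>

definition times_coquat :: "coquat \<Rightarrow> coquat \<Rightarrow> coquat" where
  "p * q = Coquat
     (cq0 p * cq0 q - cq1 p * cq1 q + cq2 p * cq2 q + cq3 p * cq3 q)
     (cq0 p * cq1 q + cq1 p * cq0 q - cq2 p * cq3 q + cq3 p * cq2 q)
     (cq0 p * cq2 q - cq1 p * cq3 q + cq2 p * cq0 q + cq3 p * cq1 q)
     (cq0 p * cq3 q + cq1 p * cq2 q - cq2 p * cq1 q + cq3 p * cq0 q)"

instance
  by standard
    (simp_all add: zero_coquat_def one_coquat_def plus_coquat_def uminus_coquat_def
      minus_coquat_def scaleR_coquat_def times_coquat_def algebra_simps)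

end

definition cq_i :: coquat where "cq_i = Coquat 0 1 0 0"
definition cq_j :: coquat where "cq_j = Coquat 0 0 1 0"
definition cq_k :: coquat where "cq_k = Coquat 0 0 0 1"

lemma coquat_basis_mult:
  "cq_i * cq_i = - 1" "cq_j * cq_j = 1" "cq_k * cq_k = 1"
  "cq_i * cq_j = cq_k" "cq_j * cq_i = - cq_k"
  "cq_j * cq_k = - cq_i" "cq_k * cq_j = cq_i"
  "cq_i * cq_k = - cq_j" "cq_k * cq_i = cq_j"
  by (simp_all add: cq_i_def cq_j_def cq_k_def one_coquat_def uminus_coquat_def times_coquat_def)

lemma coquat_basis_expansion:
  "q = of_real (cq0 q) + cq1 q *\<^sub>R cq_i + cq2 q *\<^sub>R cq_j + cq3 q *\<^sub>R cq_k"
  by (simp add: of_real_def cq_i_def cq_j_def cq_k_def one_coquat_def plus_coquat_def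
      scaleR_coquat_def)

definition cq_cnj :: "coquat \<Rightarrow> coquat" where
  "cq_cnj q = Coquat (cq0 q) (- cq1 q) (- cq2 q) (- cq3 q)"

section \<open>Matrices over the coquaternions\<close>

text \<open>The library's \<open>mat_adjoint\<close> is not applicable: it is restricted to fields with a
  multiplicative conjugation, whereas \<open>cq_cnj\<close> reverses products.\<close>

definition cq_adjoint :: "coquat mat \<Rightarrow> coquat mat" where
  "cq_adjoint A = mat (dim_col A) (dim_row A) (\<lambda>(i, j). cq_cnj (A $$ (j, i)))"

definition cq_hermitian :: "coquat mat \<Rightarrow> bool" where
  "cq_hermitian A \<longleftrightarrow> square_mat A \<and> cq_adjoint A = A"

text \<open>Row analogue of \<^const>\<open>replace_col\<close>.\<close>

definition replace_row :: "'a mat \<Rightarrow> 'a vec \<Rightarrow> nat \<Rightarrow> 'a mat" where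
  "replace_row A b k =
     mat (dim_row A) (dim_col A) (\<lambda>(i, j). if i = k then b $ j else A $$ (i, j))"

section \<open>Row and column determinants\<close>

text \<open>Indices range over \<open>{0..<n}\<close>. For a permutation \<open>\<sigma>\<close> of \<open>{0..<n}\<close>, the set \<open>orbit \<sigma> s\<close>
  contains \<open>s\<close> and is the cycle of \<open>\<sigma>\<close> through \<open>s\<close>.\<close>

definition perm_cycles :: "nat \<Rightarrow> (nat \<Rightarrow> nat) \<Rightarrow> nat set set" where
  "perm_cycles n \<sigma> = orbit \<sigma> ` {0..<n}"

text \<open>The product \<open>a(s, \<sigma> s) a(\<sigma> s, \<sigma>\<^sup>2 s) \<dots> a(\<sigma>\<^sup>-\<^sup>1 s, s)\<close>.\<close>

definition cycle_prod :: "coquat mat \<Rightarrow> (nat \<Rightarrow> nat) \<Rightarrow> nat \<Rightarrow> coquat" where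
  "cycle_prod A \<sigma> s =
     prod_list (map (\<lambda>t. A $$ ((\<sigma> ^^ t) s, (\<sigma> ^^ Suc t) s)) [0..<card (orbit \<sigma> s)])"

text \<open>The starting points \<open>[i, m\<^sub>2, \<dots>, m\<^sub>r]\<close>: \<open>i\<close> for its own cycle, followed by the minima of the
  other cycles in increasing order.\<close>

definition cycle_starts :: "nat \<Rightarrow> nat \<Rightarrow> (nat \<Rightarrow> nat) \<Rightarrow> nat list" where
  "cycle_starts n i \<sigma> = i # sorted_list_of_set (Min ` (perm_cycles n \<sigma> - {orbit \<sigma> i}))"

definition rdet :: "nat \<Rightarrow> coquat mat \<Rightarrow> coquat" where
  "rdet i A = (let n = dim_row A in
     \<Sum>\<sigma> | \<sigma> permutes {0..<n}.
       (- 1) ^ (n - card (perm_cycles n \<sigma>)) *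
       prod_list (map (cycle_prod A \<sigma>) (cycle_starts n i \<sigma>)))"

definition cdet :: "nat \<Rightarrow> coquat mat \<Rightarrow> coquat" where
  "cdet i A = (let n = dim_row A in
     \<Sum>\<sigma> | \<sigma> permutes {0..<n}.
       (- 1) ^ (n - card (perm_cycles n \<sigma>)) *
       prod_list (map (cycle_prod A \<sigma>) (rev (cycle_starts n i \<sigma>))))"

text \<open>The common real value of all row and column determinants; meaningful for Hermitian matrices
  of positive size.\<close>

definition hdet :: "coquat mat \<Rightarrow> real" where
  "hdet A = (THE d. \<forall>i<dim_row A. rdet i A = of_real d \<and> cdet i A = of_real d)"

end

theory Submission
  imports Defs "HOL-Combinatorics.Cycles"
begin

text \<open>
  Splitting off the cycle through \<open>i\<close> expands the row determinant \<open>D(T)\<close> of a matrix with index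
  set \<open>T\<close> as the sum of \<open>(-1)\<^bsup>|xs|\<^esup> p\<^sub>i\<^sub>i(xs) D(T - {i} - xs)\<close> over the repetition-free lists \<open>xs\<close> in
  \<open>T - {i}\<close>, where \<open>p\<^sub>u\<^sub>v(xs)\<close> is the product of the entries along the path \<open>u, xs, v\<close>. For a
  Hermitian matrix, we show by induction on \<open>T\<close> that \<open>D(T)\<close> is real and independent of the choice of
  \<open>i\<close>. The minors are then real, hence central, and expanding those that still contain \<open>j\<close> turns the
  sum into one of \<open>\<plusminus> (p\<^sub>j\<^sub>j(xs) p\<^sub>i\<^sub>i(ys) - p\<^sub>i\<^sub>j(xs) p\<^sub>j\<^sub>i(ys)) D(T - {i, j} - xs - ys)\<close> over disjoint
  \<open>xs\<close> and \<open>ys\<close>. Reversing a path conjugates its product, so the sum is real and determined by its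
  trace, the map sending \<open>q\<close> to the sum of \<open>q\<close> and its conjugate; and the trace is symmetric in \<open>i\<close>
  and \<open>j\<close> because \<open>p q\<close> and \<open>q p\<close> have the same trace.

  When row \<open>i\<close> is replaced by row \<open>j\<close>, the paths leaving \<open>i\<close> become paths leaving \<open>j\<close>, and the sum
  vanishes term by term. Hence the cofactors form a right inverse. The adjoint exchanges row and
  column determinants and makes this right inverse a left inverse as well, so the solution is
  \<open>A\<^sup>-\<^sup>1 C B\<^sup>-\<^sup>1\<close>, and the two formulas are the two ways of bracketing this product.
\<close>

section \<open>Products along paths\<close>

fun path_prod :: "('i \<Rightarrow> 'i \<Rightarrow> 'a :: semigroup_mult) \<Rightarrow> ('i \<Rightarrow> 'a) \<Rightarrow> 'i list \<Rightarrow> 'i \<Rightarrow> 'a" where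
  "path_prod a b [] y = b y"
| "path_prod a b (x # xs) y = b x * path_prod a (a x) xs y"

lemma path_prod_append:
  "path_prod a b (xs @ z # ys) y = path_prod a b xs z * path_prod a (a z) ys y"
  by (induction xs arbitrary: b) (simp_all add: mult.assoc)

lemma path_prod_cong:
  assumes "\<And>v. v \<in> insert y (set xs) \<Longrightarrow> b v = b' v"
    and "\<And>u v. u \<in> set xs \<Longrightarrow> v \<in> insert y (set xs) \<Longrightarrow> a u v = a' u v"
  shows "path_prod a b xs y = path_prod a' b' xs y"
  using assms
proof (induction xs arbitrary: b b')
  case (Cons x xs)
  have "path_prod a (a x) xs y = path_prod a' (a' x) xs y"
    by (rule Cons.IH) (use Cons.prems in auto)
  with Cons.prems show ?case by simp
qed simp

lemma path_prod_eq_sum_unit: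
  fixes a :: "'i \<Rightarrow> 'i \<Rightarrow> 'a :: semiring_1"
  assumes "finite T" "insert y (set xs) \<subseteq> T"
  shows "path_prod a b xs y = (\<Sum>j\<in>T. b j * path_prod a (\<lambda>l. if l = j then 1 else 0) xs y)"
  using assms by (cases xs) (simp_all add: if_distrib if_distribR cong: if_cong)

lemma path_prod_map_upt:
  fixes a :: "'i \<Rightarrow> 'i \<Rightarrow> 'a :: monoid_mult"
  assumes "m < n"
  shows "path_prod a (a (f m)) (map f [Suc m..<n]) (f n) =
    prod_list (map (\<lambda>t. a (f t) (f (Suc t))) [m..<n])"
  using assms
proof (induction n)
  case (Suc n)
  then consider "m = n" | "m < n" by linarith
  then show ?case
    by cases (use Suc.IH in \<open>simp_all add: path_prod_append\<close>)
qed simp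

section \<open>Sums over repetition-free lists\<close>

definition distinct_lists :: "'a set \<Rightarrow> 'a list set" where
  "distinct_lists S = {xs. set xs \<subseteq> S \<and> distinct xs}"

definition distinct_list_pairs :: "'a set \<Rightarrow> ('a list \<times> 'a list) set" where
  "distinct_list_pairs S = {(xs, ys). xs @ ys \<in> distinct_lists S}"

lemma finite_distinct_lists: "finite S \<Longrightarrow> finite (distinct_lists S)"
  unfolding distinct_lists_def by (rule finite_subset_distinct)

lemma sum_rev_distinct_lists:
  "(\<Sum>xs\<in>distinct_lists S. f (rev xs)) = (\<Sum>xs\<in>distinct_lists S. f xs)"
  by (rule sum.reindex_bij_witness[where i = rev and j = rev]) (auto simp: distinct_lists_def)

lemma sum_distinct_list_pairs:
  assumes "finite S"
  shows "(\<Sum>(xs, ys)\<in>distinct_list_pairs S. f xs ys) =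
    (\<Sum>xs\<in>distinct_lists S. \<Sum>ys\<in>distinct_lists (S - set xs). f xs ys)"
proof -
  have "distinct_list_pairs S = (SIGMA xs:distinct_lists S. distinct_lists (S - set xs))"
    by (auto simp: distinct_list_pairs_def distinct_lists_def)
  then show ?thesis
    using assms by (simp add: sum.Sigma finite_distinct_lists)
qed

lemma sum_distinct_list_pairs_swap:
  "(\<Sum>(xs, ys)\<in>distinct_list_pairs S. f xs ys) = (\<Sum>(xs, ys)\<in>distinct_list_pairs S. f ys xs)"
  by (rule sum.reindex_bij_witness[where i = prod.swap and j = prod.swap])
    (auto simp: distinct_list_pairs_def distinct_lists_def)

lemma bij_betw_distinct_list_pairs:
  assumes "j \<in> S"
  shows "bij_betw (\<lambda>(xs, ys). xs @ j # ys) (distinct_list_pairs (S - {j}))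
    {zs \<in> distinct_lists S. j \<in> set zs}"
  unfolding bij_betw_def
proof
  show "inj_on (\<lambda>(xs, ys). xs @ j # ys) (distinct_list_pairs (S - {j}))"
  proof (rule inj_on_subset)
    show "inj_on (\<lambda>(xs, ys). xs @ j # ys) {(xs, ys). j \<notin> set xs \<and> j \<notin> set ys}"
      by (auto simp: inj_on_def append_Cons_eq_iff)
  qed (auto simp: distinct_list_pairs_def distinct_lists_def)
next
  let ?h = "\<lambda>(xs, ys). xs @ j # ys"
  show "?h ` distinct_list_pairs (S - {j}) = {zs \<in> distinct_lists S. j \<in> set zs}"
  proof
    show "?h ` distinct_list_pairs (S - {j}) \<subseteq> {zs \<in> distinct_lists S. j \<in> set zs}"
      using assms by (auto simp: distinct_list_pairs_def distinct_lists_def)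
    show "{zs \<in> distinct_lists S. j \<in> set zs} \<subseteq> ?h ` distinct_list_pairs (S - {j})"
    proof
      fix zs assume zs: "zs \<in> {zs \<in> distinct_lists S. j \<in> set zs}"
      then obtain xs ys where split: "zs = xs @ j # ys" by (auto dest: split_list)
      with zs have "(xs, ys) \<in> distinct_list_pairs (S - {j})"
        by (auto simp: distinct_list_pairs_def distinct_lists_def)
      with split show "zs \<in> ?h ` distinct_list_pairs (S - {j})" by force
    qed
  qed
qed

lemma sum_distinct_lists_split:
  fixes f :: "'a list \<Rightarrow> 'b :: comm_monoid_add"
  assumes "finite S" "j \<in> S"
  shows "sum f (distinct_lists S) = sum f (distinct_lists (S - {j})) +
    (\<Sum>(xs, ys)\<in>distinct_list_pairs (S - {j}). f (xs @ j # ys))"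
proof -
  have "sum f (distinct_lists S) = sum f {xs \<in> distinct_lists S. j \<notin> set xs} +
      sum f {xs \<in> distinct_lists S. j \<in> set xs}"
    by (subst sum.union_disjoint[symmetric])
      (auto simp: finite_distinct_lists assms(1) intro: sum.cong)
  also have "{xs \<in> distinct_lists S. j \<notin> set xs} = distinct_lists (S - {j})"
    by (auto simp: distinct_lists_def)
  also have "sum f {xs \<in> distinct_lists S. j \<in> set xs} =
      (\<Sum>(xs, ys)\<in>distinct_list_pairs (S - {j}). f (xs @ j # ys))"
    using sum.reindex_bij_betw[OF bij_betw_distinct_list_pairs[OF assms(2)], of f]
    by (simp add: case_prod_unfold)
  finally show ?thesis .
qed

section \<open>Cycles of a permutation\<close>

definition cycle_tail :: "('a \<Rightarrow> 'a) \<Rightarrow> 'a \<Rightarrow> 'a list" where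
  "cycle_tail \<sigma> s = tl (support \<sigma> s)"

lemma Cons_cycle_tail:
  assumes "permutation \<sigma>" shows "s # cycle_tail \<sigma> s = support \<sigma> s"
  using least_power_of_permutation(2)[OF assms, of s]
  by (simp add: cycle_tail_def map_tl upt_conv_Cons)

lemma distinct_cycle_tail:
  assumes "permutation \<sigma>" shows "distinct (s # cycle_tail \<sigma> s)"
  unfolding Cons_cycle_tail[OF assms] by (rule cycle_of_permutation[OF assms])

lemma set_cycle_tail:
  assumes "permutation \<sigma>" shows "set (s # cycle_tail \<sigma> s) = orbit \<sigma> s"
  unfolding Cons_cycle_tail[OF assms] support_set[OF assms] orbit_altdef_permutation[OF assms]
  by auto

lemma card_orbit_eq_Suc_length_cycle_tail:
  assumes "permutation \<sigma>" shows "card (orbit \<sigma> s) = Suc (length (cycle_tail \<sigma> s))"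
  using distinct_card[OF distinct_cycle_tail[OF assms, of s]] unfolding set_cycle_tail[OF assms]
  by simp

lemma least_power_eq_card_orbit:
  assumes "permutation \<sigma>" shows "least_power \<sigma> s = card (orbit \<sigma> s)"
  using arg_cong[OF Cons_cycle_tail[OF assms], of length s]
  by (simp add: card_orbit_eq_Suc_length_cycle_tail[OF assms])

lemma map_cycle_tail:
  assumes "permutation \<sigma>" shows "map \<sigma> (s # cycle_tail \<sigma> s) = cycle_tail \<sigma> s @ [s]"
proof -
  have "map \<sigma> (support \<sigma> s) = map (cycle_of_list (support \<sigma> s)) (support \<sigma> s)"
    by (rule map_cong[OF refl cycle_restrict[OF assms]])
  also have "\<dots> = rotate1 (support \<sigma> s)"
    using cyclic_rotation[OF cycle_of_permutation[OF assms], of 1] by simp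
  finally show ?thesis
    unfolding Cons_cycle_tail[OF assms, symmetric] by simp
qed

lemma cycle_tail_eqI:
  assumes "distinct (s # xs)" "map \<sigma> (s # xs) = xs @ [s]"
  shows "cycle_tail \<sigma> s = xs"
proof -
  let ?c = "s # xs"
  have rotate: "map (\<sigma> ^^ t) ?c = rotate t ?c" for t
  proof (induction t)
    case (Suc t)
    have "map (\<sigma> ^^ Suc t) ?c = map \<sigma> (map (\<sigma> ^^ t) ?c)" by simp
    also have "\<dots> = rotate t (map \<sigma> ?c)" by (simp only: Suc.IH rotate_map)
    also have "\<dots> = rotate (Suc t) ?c"
      by (simp only: assms(2) rotate_Suc rotate1_rotate_swap rotate1.simps)
    finally show ?case .
  qed simp
  have pow: "(\<sigma> ^^ t) s = ?c ! (t mod length ?c)" for t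
    using arg_cong[OF rotate[of t], of hd] by (simp add: hd_rotate_conv_nth)
  have "least_power \<sigma> s = length ?c"
    unfolding least_power_def
  proof (rule Least_equality)
    fix t assume t: "(\<sigma> ^^ t) s = s \<and> 0 < t"
    then have "?c ! (t mod length ?c) = ?c ! 0" by (simp add: pow)
    then have "t mod length ?c = 0"
      using nth_eq_iff_index_eq[OF assms(1), of "t mod length ?c" 0] by simp
    with t show "length ?c \<le> t" by (auto intro: dvd_imp_le)
  qed (simp add: pow del: funpow.simps)
  then have "support \<sigma> s = ?c"
    by (intro nth_equalityI) (simp_all add: pow del: upt_Suc)
  then show ?thesis by (simp add: cycle_tail_def)
qed

lemma cycle_tail_inv:
  assumes "permutation \<sigma>" shows "cycle_tail (Hilbert_Choice.inv \<sigma>) s = rev (cycle_tail \<sigma> s)"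
proof (rule cycle_tail_eqI)
  show "distinct (s # rev (cycle_tail \<sigma> s))"
    using distinct_cycle_tail[OF assms, of s] by simp
  have "inj \<sigma>" using assms by (simp add: permutation_bijective bij_is_inj)
  have "map (Hilbert_Choice.inv \<sigma>) (s # rev (cycle_tail \<sigma> s)) =
      rev (map (Hilbert_Choice.inv \<sigma>) (cycle_tail \<sigma> s @ [s]))"
    by (simp add: rev_map)
  also have "\<dots> = rev (map (Hilbert_Choice.inv \<sigma>) (map \<sigma> (s # cycle_tail \<sigma> s)))"
    by (simp only: map_cycle_tail[OF assms])
  also have "\<dots> = rev (cycle_tail \<sigma> s) @ [s]"
    by (simp add: inv_o_cancel[OF \<open>inj \<sigma>\<close>] inv_f_f[OF \<open>inj \<sigma>\<close>])
  finally show "map (Hilbert_Choice.inv \<sigma>) (s # rev (cycle_tail \<sigma> s)) =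
      rev (cycle_tail \<sigma> s) @ [s]" .
qed

lemma orbit_eq_iff:
  assumes "permutation \<sigma>" shows "orbit \<sigma> s = orbit \<sigma> i \<longleftrightarrow> s \<in> orbit \<sigma> i"
  using orbit_cyclic_eq3[OF cyclic_on_orbit'[OF assms]] permutation_self_in_orbit[OF assms] by metis

subsection \<open>Splitting off a cycle\<close>

lemma perm_restrict_permutes_Diff_orbit:
  assumes "finite T" "\<sigma> permutes T"
  shows "perm_restrict \<sigma> (T - orbit \<sigma> i) permutes T - orbit \<sigma> i"
  by (rule perm_restrict_diff_cyclic[OF assms(2) cyclic_on_orbit[OF assms(2,1)]])

lemma perm_restrict_Diff_orbit_comp_cycle:
  assumes "finite T" "\<sigma> permutes T" "i \<in> T"
  shows "perm_restrict \<sigma> (T - orbit \<sigma> i) \<circ> cycle_of_list (i # cycle_tail \<sigma> i) = \<sigma>"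
proof -
  have \<sigma>: "permutation \<sigma>" using permutation_permutes assms by blast
  have "cycle_of_list (i # cycle_tail \<sigma> i) = perm_restrict \<sigma> (orbit \<sigma> i)"
  proof
    fix x show "cycle_of_list (i # cycle_tail \<sigma> i) x = perm_restrict \<sigma> (orbit \<sigma> i) x"
      unfolding set_cycle_tail[OF \<sigma>, symmetric] unfolding Cons_cycle_tail[OF \<sigma>]
      by (metis \<sigma> cycle_restrict id_outside_supp perm_restrict_def)
  qed
  moreover have "perm_restrict \<sigma> (T - orbit \<sigma> i) \<circ> perm_restrict \<sigma> (orbit \<sigma> i) =
      perm_restrict \<sigma> (T - orbit \<sigma> i \<union> orbit \<sigma> i)"
    by (rule perm_restrict_comp) (auto intro: cyclic_on_orbit' \<sigma>)
  moreover have "T - orbit \<sigma> i \<union> orbit \<sigma> i = T"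
    using permutes_orbit_subset[OF assms(2,3)] by blast
  ultimately show ?thesis using assms(2) by simp
qed

lemma cycle_tail_comp_cycle_of_list:
  assumes "distinct (i # xs)" "\<And>x. x \<in> set (i # xs) \<Longrightarrow> \<tau> x = x"
  shows "cycle_tail (\<tau> \<circ> cycle_of_list (i # xs)) i = xs"
proof (rule cycle_tail_eqI[OF assms(1)])
  have "map (\<tau> \<circ> cycle_of_list (i # xs)) (i # xs) = map \<tau> (rotate1 (i # xs))"
    using arg_cong[OF cyclic_rotation[OF assms(1), of 1], of "map \<tau>"]
    by (simp del: cycle_of_list.simps)
  also have "\<dots> = xs @ [i]"
    using assms(2) by (simp add: map_idI)
  finally show "map (\<tau> \<circ> cycle_of_list (i # xs)) (i # xs) = xs @ [i]" .
qed

lemma comp_cycle_of_list_permutes: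
  assumes "i \<in> T" "set xs \<subseteq> T" "\<tau> permutes T - set (i # xs)"
  shows "\<tau> \<circ> cycle_of_list (i # xs) permutes T"
  using assms
  by (intro permutes_compose permutes_subset[OF cycle_permutes] permutes_subset[OF assms(3)]) auto

lemma perm_restrict_comp_cycle_of_list:
  assumes "\<tau> permutes T - set (i # xs)"
  shows "perm_restrict (\<tau> \<circ> cycle_of_list (i # xs)) (T - set (i # xs)) = \<tau>"
proof
  fix x
  show "perm_restrict (\<tau> \<circ> cycle_of_list (i # xs)) (T - set (i # xs)) x = \<tau> x"
    using permutes_not_in[OF assms, of x] id_outside_supp[of x "i # xs"]
    by (auto simp: perm_restrict_def simp del: cycle_of_list.simps)
qed

lemma sum_permutes_split_cycle:
  fixes f :: "'a list \<Rightarrow> ('a \<Rightarrow> 'a) \<Rightarrow> 'b :: comm_monoid_add"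
  assumes "finite T" "i \<in> T"
  shows "(\<Sum>\<sigma> | \<sigma> permutes T. f (cycle_tail \<sigma> i) (perm_restrict \<sigma> (T - orbit \<sigma> i))) =
    (\<Sum>xs\<in>distinct_lists (T - {i}). \<Sum>\<tau> | \<tau> permutes T - set (i # xs). f xs \<tau>)"
proof -
  let ?P = "SIGMA xs:distinct_lists (T - {i}). {\<tau>. \<tau> permutes T - set (i # xs)}"
  let ?split = "\<lambda>\<sigma>. (cycle_tail \<sigma> i, perm_restrict \<sigma> (T - orbit \<sigma> i))"
  let ?join = "\<lambda>(xs, \<tau>). \<tau> \<circ> cycle_of_list (i # xs)"
  have permutation: "permutation \<sigma>" if "\<sigma> permutes T" for \<sigma>
    using that assms(1) permutation_permutes by blast
  have split_in: "?split \<sigma> \<in> ?P" if "\<sigma> permutes T" for \<sigma>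
    using distinct_cycle_tail[OF permutation[OF that], of i]
      permutes_orbit_subset[OF that assms(2)]
      perm_restrict_permutes_Diff_orbit[OF assms(1) that, of i]
    unfolding set_cycle_tail[OF permutation[OF that], of i, symmetric]
    by (auto simp: distinct_lists_def)
  have join_permutes: "?join (xs, \<tau>) permutes T" and split_join: "?split (?join (xs, \<tau>)) = (xs, \<tau>)"
    if "(xs, \<tau>) \<in> ?P" for xs \<tau>
  proof -
    have xs: "distinct (i # xs)" "set xs \<subseteq> T" and \<tau>: "\<tau> permutes T - set (i # xs)"
      using that by (auto simp: distinct_lists_def)
    let ?\<sigma> = "\<tau> \<circ> cycle_of_list (i # xs)"
    show perm: "?join (xs, \<tau>) permutes T"
      using comp_cycle_of_list_permutes[OF assms(2) xs(2) \<tau>] by (simp only: prod.case)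
    have tail: "cycle_tail ?\<sigma> i = xs"
      using \<tau> by (intro cycle_tail_comp_cycle_of_list[OF xs(1)]) (auto simp: permutes_def)
    have "orbit ?\<sigma> i = set (i # xs)"
      using perm set_cycle_tail[OF permutation, of ?\<sigma> i] unfolding tail prod.case by blast
    then show "?split (?join (xs, \<tau>)) = (xs, \<tau>)"
      by (simp only: prod.case tail perm_restrict_comp_cycle_of_list[OF \<tau>])
  qed
  have "(\<Sum>\<sigma> | \<sigma> permutes T. f (cycle_tail \<sigma> i) (perm_restrict \<sigma> (T - orbit \<sigma> i))) =
      (\<Sum>(xs, \<tau>)\<in>?P. f xs \<tau>)"
  proof (rule sum.reindex_bij_witness[where j = ?split and i = ?join])
    show "?join (?split \<sigma>) = \<sigma>" if "\<sigma> \<in> {\<sigma>. \<sigma> permutes T}" for \<sigma>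
      using that assms perm_restrict_Diff_orbit_comp_cycle by (simp only: prod.case mem_Collect_eq)
  qed (use split_in join_permutes split_join in auto)
  then show ?thesis
    using assms by (simp add: sum.Sigma finite_distinct_lists finite_permutations)
qed

lemma
  assumes "finite T" "\<sigma> permutes T" "s \<in> T - orbit \<sigma> i"
  defines "\<tau> \<equiv> perm_restrict \<sigma> (T - orbit \<sigma> i)"
  shows orbit_perm_restrict: "orbit \<tau> s = orbit \<sigma> s"
    and cycle_tail_perm_restrict: "cycle_tail \<tau> s = cycle_tail \<sigma> s"
proof -
  have \<tau>: "\<tau> permutes T - orbit \<sigma> i"
    unfolding \<tau>_def by (rule perm_restrict_permutes_Diff_orbit[OF assms(1,2)])
  have "(\<tau> ^^ t) s = (\<sigma> ^^ t) s \<and> (\<tau> ^^ t) s \<in> T - orbit \<sigma> i" for t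
  proof (induction t)
    case (Suc t)
    moreover have "\<tau> x = \<sigma> x" if "x \<in> T - orbit \<sigma> i" for x
      unfolding \<tau>_def using that by (rule perm_restrict_simps(1))
    ultimately show ?case
      using permutes_in_image[OF \<tau>, of "(\<tau> ^^ t) s"] by (metis funpow.simps(2) comp_apply)
  qed (use assms(3) in simp)
  then have pow: "(\<tau> ^^ t) s = (\<sigma> ^^ t) s" for t by blast
  then show "orbit \<tau> s = orbit \<sigma> s" "cycle_tail \<tau> s = cycle_tail \<sigma> s"
    unfolding orbit_altdef cycle_tail_def least_power_def by simp_all
qed

lemma orbits_perm_restrict:
  assumes "finite T" "\<sigma> permutes T"
  shows "orbit (perm_restrict \<sigma> (T - orbit \<sigma> i)) ` (T - orbit \<sigma> i) = orbit \<sigma> ` T - {orbit \<sigma> i}"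
proof -
  have \<sigma>: "permutation \<sigma>" using permutation_permutes assms by blast
  have "orbit (perm_restrict \<sigma> (T - orbit \<sigma> i)) ` (T - orbit \<sigma> i) = orbit \<sigma> ` (T - orbit \<sigma> i)"
    by (rule image_cong[OF refl]) (rule orbit_perm_restrict[OF assms])
  also have "\<dots> = orbit \<sigma> ` T - {orbit \<sigma> i}"
    using orbit_eq_iff[OF \<sigma>] by blast
  finally show ?thesis .
qed

lemma card_Diff_orbits_split:
  assumes "finite T" "\<sigma> permutes T" "i \<in> T"
  defines "U \<equiv> T - orbit \<sigma> i"
  shows "card T - card (orbit \<sigma> ` T) =
    length (cycle_tail \<sigma> i) + (card U - card (orbit (perm_restrict \<sigma> U) ` U))"
proof -
  have \<sigma>: "permutation \<sigma>" using permutation_permutes assms by blast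
  have "card T = Suc (length (cycle_tail \<sigma> i)) + card U"
    unfolding U_def card_orbit_eq_Suc_length_cycle_tail[OF \<sigma>, symmetric]
    using permutes_orbit_subset[OF assms(2,3)] assms(1)
    by (metis card_Diff_subset card_mono finite_subset le_add_diff_inverse)
  moreover have "card (orbit \<sigma> ` T) = Suc (card (orbit (perm_restrict \<sigma> U) ` U))"
    unfolding U_def orbits_perm_restrict[OF assms(1,2)] using assms by (intro card.remove) auto
  moreover have "card (orbit (perm_restrict \<sigma> U) ` U) \<le> card U"
    unfolding U_def using assms(1) by (intro card_image_le) auto
  ultimately show ?thesis by linarith
qed

lemma Min_orbit_in:
  assumes "permutation \<sigma>" shows "Min (orbit \<sigma> s) \<in> orbit \<sigma> s"
  by (intro Min_in orbit_nonempty finite_orbit permutation_self_in_orbit assms)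

lemma sorted_list_of_set_orbit_minima:
  fixes T :: "'i :: linorder set"
  assumes "finite T" "T \<noteq> {}" "\<sigma> permutes T"
  shows "sorted_list_of_set (Min ` orbit \<sigma> ` T) =
    Min T # sorted_list_of_set (Min ` (orbit \<sigma> ` T - {orbit \<sigma> (Min T)}))"
proof -
  let ?m = "Min T"
  have \<sigma>: "permutation \<sigma>" using permutation_permutes assms by blast
  have m: "?m \<in> T" using assms by simp
  have sub: "orbit \<sigma> s \<subseteq> T" if "s \<in> T" for s
    using permutes_orbit_subset[OF assms(3) that] .
  have min_m: "Min (orbit \<sigma> ?m) = ?m"
    using sub[OF m] assms(1) permutation_self_in_orbit[OF \<sigma>]
    by (intro Min_eqI) (auto intro: finite_subset)
  have "Min (Min ` orbit \<sigma> ` T) = ?m"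
  proof (rule Min_eqI)
    show "?m \<le> y" if "y \<in> Min ` orbit \<sigma> ` T" for y
      using that Min_orbit_in[OF \<sigma>] sub assms(1) by (auto intro!: Min_le)
    show "?m \<in> Min ` orbit \<sigma> ` T" using m min_m by (metis image_eqI)
  qed (use assms in simp)
  moreover have "Min (orbit \<sigma> s) \<noteq> ?m" if "orbit \<sigma> s \<noteq> orbit \<sigma> ?m" for s
    using Min_orbit_in[OF \<sigma>, of s] that orbit_eq_iff[OF \<sigma>] by metis
  then have "Min ` orbit \<sigma> ` T - {?m} = Min ` (orbit \<sigma> ` T - {orbit \<sigma> ?m})"
    using min_m by auto
  ultimately show ?thesis
    using sorted_list_of_set_nonempty[of "Min ` orbit \<sigma> ` T"] assms by simp
qed

section \<open>Row determinants over a finite index set\<close>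

definition cycle_weight :: "('i \<Rightarrow> 'i \<Rightarrow> 'a :: semigroup_mult) \<Rightarrow> ('i \<Rightarrow> 'i) \<Rightarrow> 'i \<Rightarrow> 'a" where
  "cycle_weight a \<sigma> s = path_prod a (a s) (cycle_tail \<sigma> s) s"

definition signed_cycle_prod ::
  "('i \<Rightarrow> 'i \<Rightarrow> 'a :: real_algebra_1) \<Rightarrow> 'i set \<Rightarrow> ('i \<Rightarrow> 'i) \<Rightarrow> 'i list \<Rightarrow> 'a" where
  "signed_cycle_prod a T \<sigma> starts =
     (- 1) ^ (card T - card (orbit \<sigma> ` T)) *\<^sub>R prod_list (map (cycle_weight a \<sigma>) starts)"

definition rdet_on :: "('i :: linorder \<Rightarrow> 'i \<Rightarrow> 'a :: real_algebra_1) \<Rightarrow> 'i set \<Rightarrow> 'a" where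
  "rdet_on a T = (\<Sum>\<sigma> | \<sigma> permutes T.
     signed_cycle_prod a T \<sigma> (sorted_list_of_set (Min ` orbit \<sigma> ` T)))"

text \<open>The expansion along row \<open>i\<close> of the row determinant of \<open>a\<close> with row \<open>i\<close> replaced by \<open>b\<close>.\<close>

definition row_expansion ::
  "('i :: linorder \<Rightarrow> 'i \<Rightarrow> 'a :: real_algebra_1) \<Rightarrow> ('i \<Rightarrow> 'a) \<Rightarrow> 'i set \<Rightarrow> 'i \<Rightarrow> 'a" where
  "row_expansion a b T i = (\<Sum>xs\<in>distinct_lists (T - {i}).
     (- 1) ^ length xs *\<^sub>R (path_prod a b xs i * rdet_on a (T - set (i # xs))))"

lemma rdet_on_empty [simp]: "rdet_on a {} = 1"
  by (simp add: rdet_on_def signed_cycle_prod_def)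

lemma signed_cycle_prod_split:
  fixes a :: "'i :: linorder \<Rightarrow> 'i \<Rightarrow> 'a :: real_algebra_1"
  assumes "finite T" "\<sigma> permutes T" "i \<in> T"
  defines "U \<equiv> T - orbit \<sigma> i"
  defines "\<tau> \<equiv> perm_restrict \<sigma> U"
  shows "signed_cycle_prod a T \<sigma>
      (i # sorted_list_of_set (Min ` (orbit \<sigma> ` T - {orbit \<sigma> i}))) =
    (- 1) ^ length (cycle_tail \<sigma> i) *\<^sub>R (cycle_weight a \<sigma> i *
      signed_cycle_prod a U \<tau> (sorted_list_of_set (Min ` orbit \<tau> ` U)))"
proof -
  have \<sigma>: "permutation \<sigma>" using permutation_permutes assms by blast
  have orbits: "orbit \<tau> ` U = orbit \<sigma> ` T - {orbit \<sigma> i}"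
    unfolding \<tau>_def U_def by (rule orbits_perm_restrict[OF assms(1,2)])
  have "cycle_weight a \<sigma> (Min (orbit \<sigma> s)) = cycle_weight a \<tau> (Min (orbit \<sigma> s))"
    if "s \<in> T" "orbit \<sigma> s \<noteq> orbit \<sigma> i" for s
  proof -
    have "orbit \<sigma> (Min (orbit \<sigma> s)) = orbit \<sigma> s"
      using orbit_eq_iff[OF \<sigma>] Min_orbit_in[OF \<sigma>] by simp
    then have "Min (orbit \<sigma> s) \<notin> orbit \<sigma> i"
      using orbit_eq_iff[OF \<sigma>] that(2) by metis
    moreover have "Min (orbit \<sigma> s) \<in> T"
      by (rule subsetD[OF permutes_orbit_subset[OF assms(2) that(1)] Min_orbit_in[OF \<sigma>]])
    ultimately have "Min (orbit \<sigma> s) \<in> T - orbit \<sigma> i" by blast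
    then show ?thesis
      unfolding cycle_weight_def \<tau>_def U_def
      by (simp only: cycle_tail_perm_restrict[OF assms(1,2)])
  qed
  then have weights: "map (cycle_weight a \<sigma>) (sorted_list_of_set (Min ` orbit \<tau> ` U)) =
      map (cycle_weight a \<tau>) (sorted_list_of_set (Min ` orbit \<tau> ` U))"
    using assms(1) by (auto simp: orbits)
  show ?thesis
    unfolding signed_cycle_prod_def orbits[symmetric] list.map weights
    using card_Diff_orbits_split[OF assms(1-3)]
    by (simp add: power_add U_def \<tau>_def)
qed

lemma sum_signed_cycle_prod_eq_row_expansion:
  fixes a :: "'i :: linorder \<Rightarrow> 'i \<Rightarrow> 'a :: real_algebra_1"
  assumes "finite T" "i \<in> T"
  shows "(\<Sum>\<sigma> | \<sigma> permutes T. signed_cycle_prod a T \<sigma>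
      (i # sorted_list_of_set (Min ` (orbit \<sigma> ` T - {orbit \<sigma> i})))) = row_expansion a (a i) T i"
proof -
  define f where "f xs \<tau> = (- 1) ^ length xs *\<^sub>R (path_prod a (a i) xs i *
      signed_cycle_prod a (T - set (i # xs)) \<tau>
        (sorted_list_of_set (Min ` orbit \<tau> ` (T - set (i # xs)))))" for xs \<tau>
  have "signed_cycle_prod a T \<sigma> (i # sorted_list_of_set (Min ` (orbit \<sigma> ` T - {orbit \<sigma> i}))) =
      f (cycle_tail \<sigma> i) (perm_restrict \<sigma> (T - orbit \<sigma> i))" if "\<sigma> permutes T" for \<sigma>
  proof -
    have \<sigma>: "permutation \<sigma>" using permutation_permutes assms(1) that by blast
    show ?thesis
      unfolding f_def set_cycle_tail[OF \<sigma>] cycle_weight_def[symmetric]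
      by (rule signed_cycle_prod_split[OF assms(1) that assms(2)])
  qed
  then have "(\<Sum>\<sigma> | \<sigma> permutes T. signed_cycle_prod a T \<sigma>
      (i # sorted_list_of_set (Min ` (orbit \<sigma> ` T - {orbit \<sigma> i})))) =
      (\<Sum>\<sigma> | \<sigma> permutes T. f (cycle_tail \<sigma> i) (perm_restrict \<sigma> (T - orbit \<sigma> i)))"
    by (intro sum.cong) auto
  also have "\<dots> = (\<Sum>xs\<in>distinct_lists (T - {i}). \<Sum>\<tau> | \<tau> permutes T - set (i # xs). f xs \<tau>)"
    by (rule sum_permutes_split_cycle[OF assms])
  also have "\<dots> = row_expansion a (a i) T i"
    unfolding f_def row_expansion_def rdet_on_def scaleR_sum_right sum_distrib_left ..
  finally show ?thesis .
qed

lemma rdet_on_eq_row_expansion_Min: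
  assumes "finite T" "T \<noteq> {}"
  shows "rdet_on a T = row_expansion a (a (Min T)) T (Min T)"
proof -
  have "Min T \<in> T" using assms by simp
  show ?thesis
    unfolding sum_signed_cycle_prod_eq_row_expansion[OF assms(1) \<open>Min T \<in> T\<close>, symmetric] rdet_on_def
    by (intro sum.cong refl) (simp add: sorted_list_of_set_orbit_minima[OF assms])
qed

lemma row_expansion_cong:
  assumes "i \<in> T" "\<And>v. v \<in> T \<Longrightarrow> b v = b' v"
    and "\<And>u v. u \<in> T - {i} \<Longrightarrow> v \<in> T \<Longrightarrow> a u v = a' u v"
    and "\<And>U. U \<subseteq> T - {i} \<Longrightarrow> rdet_on a U = rdet_on a' U"
  shows "row_expansion a b T i = row_expansion a' b' T i"
  unfolding row_expansion_def
proof (intro sum.cong refl)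
  fix xs assume "xs \<in> distinct_lists (T - {i})"
  then have "set xs \<subseteq> T - {i}" by (simp add: distinct_lists_def)
  then have "path_prod a b xs i = path_prod a' b' xs i"
    using assms(1-3) by (intro path_prod_cong) blast+
  moreover have "rdet_on a (T - set (i # xs)) = rdet_on a' (T - set (i # xs))"
    by (rule assms(4)) auto
  ultimately show "(- 1) ^ length xs *\<^sub>R (path_prod a b xs i * rdet_on a (T - set (i # xs))) =
      (- 1) ^ length xs *\<^sub>R (path_prod a' b' xs i * rdet_on a' (T - set (i # xs)))"
    by simp
qed

lemma rdet_on_cong:
  assumes "finite T" "\<And>u v. u \<in> T \<Longrightarrow> v \<in> T \<Longrightarrow> a u v = a' u v"
  shows "rdet_on a T = rdet_on a' T"
  using assms
proof (induction T rule: finite_psubset_induct)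
  case (psubset T)
  show ?case
  proof (cases "T = {}")
    case False
    with \<open>finite T\<close> have "Min T \<in> T" by simp
    then show ?thesis
      unfolding rdet_on_eq_row_expansion_Min[OF \<open>finite T\<close> False]
      by (intro row_expansion_cong psubset.IH psubset.prems) auto
  qed simp
qed

lemma row_expansion_eq_sum_unit:
  assumes "finite T" "i \<in> T"
  shows "row_expansion a b T i =
    (\<Sum>j\<in>T. b j * row_expansion a (\<lambda>l. if l = j then 1 else 0) T i)"
proof -
  have "row_expansion a b T i = (\<Sum>xs\<in>distinct_lists (T - {i}). \<Sum>j\<in>T. b j *
      ((- 1) ^ length xs *\<^sub>R (path_prod a (\<lambda>l. if l = j then 1 else 0) xs i *
        rdet_on a (T - set (i # xs)))))"
    unfolding row_expansion_def
  proof (intro sum.cong refl)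
    fix xs assume "xs \<in> distinct_lists (T - {i})"
    then have "insert i (set xs) \<subseteq> T" using assms(2) by (auto simp: distinct_lists_def)
    then show "(- 1) ^ length xs *\<^sub>R (path_prod a b xs i * rdet_on a (T - set (i # xs))) =
        (\<Sum>j\<in>T. b j * ((- 1) ^ length xs *\<^sub>R (path_prod a (\<lambda>l. if l = j then 1 else 0) xs i *
          rdet_on a (T - set (i # xs)))))"
      by (subst path_prod_eq_sum_unit[OF assms(1)])
        (simp_all add: sum_distrib_right scaleR_sum_right mult.assoc)
  qed
  also have "\<dots> = (\<Sum>j\<in>T. b j * row_expansion a (\<lambda>l. if l = j then 1 else 0) T i)"
    unfolding row_expansion_def sum_distrib_left by (rule sum.swap)
  finally show ?thesis .
qed

definition real_row_independent ::
  "('i :: linorder \<Rightarrow> 'i \<Rightarrow> 'a :: real_algebra_1) \<Rightarrow> 'i set \<Rightarrow> bool" where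
  "real_row_independent a T \<longleftrightarrow> rdet_on a T \<in> \<real> \<and> (\<forall>i\<in>T. row_expansion a (a i) T i = rdet_on a T)"

lemma rdet_on_minor_in_Reals:
  assumes "i \<in> T" "\<forall>U\<subset>T. real_row_independent a U"
  shows "rdet_on a (T - set (i # xs)) \<in> \<real>"
proof -
  have "T - set (i # xs) \<subset> T" using assms(1) by auto
  then show ?thesis using assms(2) by (simp add: real_row_independent_def)
qed

lemma Reals_commute: "r \<in> \<real> \<Longrightarrow> r * q = q * r" for q :: "'a :: real_algebra_1"
  by (auto elim!: Reals_cases simp: of_real_def)

lemma row_expansion_split_at:
  fixes a :: "'i :: linorder \<Rightarrow> 'i \<Rightarrow> 'a :: real_algebra_1"
  assumes "finite T" "j \<in> T" "i \<noteq> j"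
  shows "row_expansion a b T i =
    (\<Sum>xs\<in>distinct_lists (T - {i, j}).
      (- 1) ^ length xs *\<^sub>R (path_prod a b xs i * rdet_on a (T - set (i # xs)))) -
    (\<Sum>(xs, ys)\<in>distinct_list_pairs (T - {i, j}). (- 1) ^ (length xs + length ys) *\<^sub>R
      (path_prod a b xs j * path_prod a (a j) ys i * rdet_on a (T - set (i # j # xs @ ys))))"
proof -
  define f where
    "f xs = (- 1) ^ length xs *\<^sub>R (path_prod a b xs i * rdet_on a (T - set (i # xs)))" for xs
  have "f (xs @ j # ys) = - ((- 1) ^ (length xs + length ys) *\<^sub>R
      (path_prod a b xs j * path_prod a (a j) ys i * rdet_on a (T - set (i # j # xs @ ys))))"
    for xs ys
    by (simp add: f_def path_prod_append insert_commute)
  moreover have "T - {i} - {j} = T - {i, j}" by auto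
  ultimately show ?thesis
    unfolding row_expansion_def f_def[symmetric]
    using assms sum_distinct_lists_split[of "T - {i}" j f]
    by (simp add: case_prod_unfold sum_negf)
qed

text \<open>The minor is real, hence central: expanded along row \<open>j\<close>, it moves in front of the path.\<close>

lemma path_prod_mult_minor:
  fixes a :: "'i :: linorder \<Rightarrow> 'i \<Rightarrow> 'a :: real_algebra_1"
  assumes "i \<in> T" "j \<in> T" "i \<noteq> j" "ys \<in> distinct_lists (T - {i, j})"
    and minors: "\<forall>U\<subset>T. real_row_independent a U"
  shows "path_prod a b ys i * rdet_on a (T - set (i # ys)) =
    (\<Sum>xs\<in>distinct_lists (T - {i, j} - set ys). (- 1) ^ length xs *\<^sub>R
      (path_prod a (a j) xs j * path_prod a b ys i * rdet_on a (T - set (i # j # xs @ ys))))"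
proof -
  let ?V = "T - set (i # ys)"
  have V: "?V \<subset> T" "j \<in> ?V" "?V - {j} = T - {i, j} - set ys"
    using assms(1-4) by (auto simp: distinct_lists_def)
  have "rdet_on a ?V = row_expansion a (a j) ?V j"
    using minors V(1,2) by (simp add: real_row_independent_def)
  then have "path_prod a b ys i * rdet_on a ?V = row_expansion a (a j) ?V j * path_prod a b ys i"
    by (metis Reals_commute rdet_on_minor_in_Reals[OF assms(1) minors])
  also have "\<dots> = (\<Sum>xs\<in>distinct_lists (T - {i, j} - set ys). (- 1) ^ length xs *\<^sub>R
      (path_prod a (a j) xs j * path_prod a b ys i * rdet_on a (T - set (i # j # xs @ ys))))"
    unfolding row_expansion_def V(3) sum_distrib_right
  proof (intro sum.cong refl)
    fix xs
    have "?V - set (j # xs) = T - set (i # j # xs @ ys)" by auto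
    then show "((- 1) ^ length xs *\<^sub>R
          (path_prod a (a j) xs j * rdet_on a (?V - set (j # xs)))) * path_prod a b ys i =
        (- 1) ^ length xs *\<^sub>R
          (path_prod a (a j) xs j * path_prod a b ys i * rdet_on a (T - set (i # j # xs @ ys)))"
      by (simp only: mult_scaleR_left mult.assoc
          Reals_commute[OF rdet_on_minor_in_Reals[OF assms(1) minors]])
  qed
  finally show ?thesis .
qed

lemma row_expansion_split:
  fixes a :: "'i :: linorder \<Rightarrow> 'i \<Rightarrow> 'a :: real_algebra_1"
  assumes "finite T" "i \<in> T" "j \<in> T" "i \<noteq> j"
    and minors: "\<forall>U\<subset>T. real_row_independent a U"
  shows "row_expansion a b T i =
    (\<Sum>(xs, ys)\<in>distinct_list_pairs (T - {i, j}). (- 1) ^ (length xs + length ys) *\<^sub>R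
      ((path_prod a (a j) xs j * path_prod a b ys i - path_prod a b xs j * path_prod a (a j) ys i) *
        rdet_on a (T - set (i # j # xs @ ys))))"
proof -
  let ?U = "T - {i, j}"
  let ?p = "\<lambda>xs ys. path_prod a (a j) xs j * path_prod a b ys i *
    rdet_on a (T - set (i # j # xs @ ys))"
  have "(\<Sum>ys\<in>distinct_lists ?U.
        (- 1) ^ length ys *\<^sub>R (path_prod a b ys i * rdet_on a (T - set (i # ys)))) =
      (\<Sum>ys\<in>distinct_lists ?U. \<Sum>xs\<in>distinct_lists (?U - set ys).
        (- 1) ^ (length ys + length xs) *\<^sub>R ?p xs ys)"
    using path_prod_mult_minor[OF assms(2-4) _ minors]
    by (intro sum.cong refl) (simp add: scaleR_sum_right power_add)
  also have "\<dots> = (\<Sum>(ys, xs)\<in>distinct_list_pairs ?U. (- 1) ^ (length ys + length xs) *\<^sub>R ?p xs ys)"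
    using assms(1) by (simp add: sum_distinct_list_pairs)
  also have "\<dots> = (\<Sum>(xs, ys)\<in>distinct_list_pairs ?U. (- 1) ^ (length xs + length ys) *\<^sub>R ?p xs ys)"
    by (subst sum_distinct_list_pairs_swap) (simp add: add.commute)
  finally show ?thesis
    unfolding row_expansion_split_at[OF assms(1,3,4)]
    by (simp add: sum_subtractf[symmetric] case_prod_unfold left_diff_distrib scaleR_diff_right)
qed

lemma row_expansion_other_row_eq_0:
  assumes "finite T" "i \<in> T" "k \<in> T" "i \<noteq> k" "\<forall>U\<subset>T. real_row_independent a U"
  shows "row_expansion a (a k) T i = 0"
  using row_expansion_split[OF assms] by simp

section \<open>Conjugations with real fixed points\<close>

text \<open>Besides the coquaternions with \<open>cq_cnj\<close>, this covers the real and complex numbers and the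
  quaternions with their usual conjugations.\<close>

locale real_conjugation =
  fixes cnj :: "'a :: real_algebra_1 \<Rightarrow> 'a"
  assumes cnj_add: "cnj (p + q) = cnj p + cnj q"
    and cnj_scaleR: "cnj (r *\<^sub>R p) = r *\<^sub>R cnj p"
    and cnj_cnj [simp]: "cnj (cnj p) = p"
    and cnj_mult: "cnj (p * q) = cnj q * cnj p"
    and Reals_if_cnj_eq: "cnj p = p \<Longrightarrow> p \<in> \<real>"
begin

lemma linear_cnj: "linear cnj"
  by (rule linearI) (rule cnj_add cnj_scaleR)+

lemmas cnj_zero = linear_0[OF linear_cnj]
  and cnj_diff = linear_diff[OF linear_cnj]
  and cnj_sum = linear_sum[OF linear_cnj]

lemma cnj_one: "cnj 1 = 1"
  by (metis cnj_cnj cnj_mult mult_1_right)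

lemma cnj_Reals: "r \<in> \<real> \<Longrightarrow> cnj r = r"
  by (auto elim!: Reals_cases simp: of_real_def cnj_scaleR cnj_one)

lemma cnj_prod_list: "cnj (prod_list ps) = prod_list (rev (map cnj ps))"
  by (induction ps) (simp_all add: cnj_one cnj_mult)

definition reduced_trace :: "'a \<Rightarrow> 'a" where
  "reduced_trace p = p + cnj p"

lemma reduced_trace_in_Reals: "reduced_trace p \<in> \<real>"
  by (rule Reals_if_cnj_eq) (simp add: reduced_trace_def cnj_add add.commute)

lemma reduced_trace_eq_double: "cnj p = p \<Longrightarrow> reduced_trace p = 2 *\<^sub>R p"
  by (simp add: reduced_trace_def scaleR_2)

lemma reduced_trace_sum: "reduced_trace (sum f S) = (\<Sum>x\<in>S. reduced_trace (f x))"
  by (simp add: reduced_trace_def cnj_sum sum.distrib)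

lemma reduced_trace_diff: "reduced_trace (p - q) = reduced_trace p - reduced_trace q"
  by (simp add: reduced_trace_def cnj_diff)

lemma reduced_trace_scaleR: "reduced_trace (r *\<^sub>R p) = r *\<^sub>R reduced_trace p"
  by (simp add: reduced_trace_def cnj_scaleR scaleR_add_right)

lemma reduced_trace_mult_Reals: "r \<in> \<real> \<Longrightarrow> reduced_trace (p * r) = reduced_trace p * r"
  using Reals_commute[of r "cnj p"]
  by (simp add: reduced_trace_def cnj_mult cnj_Reals distrib_right)

lemma reduced_trace_mult_commute: "reduced_trace (p * q) = reduced_trace (q * p)"
proof -
  let ?s = "reduced_trace p" and ?t = "reduced_trace q"
  have cnj: "cnj p = ?s - p" "cnj q = ?t - q" by (simp_all add: reduced_trace_def)
  have "?s * q = q * ?s" "?t * p = p * ?t" "?s * ?t = ?t * ?s"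
    by (rule Reals_commute[OF reduced_trace_in_Reals])+
  then have "p * q + (?t - q) * (?s - p) = q * p + (?s - p) * (?t - q)"
    by (simp add: algebra_simps)
  then show ?thesis
    by (simp only: reduced_trace_def[of "_ * _"] cnj_mult cnj)
qed

lemma cnj_path_prod:
  assumes "\<And>u v. u \<in> insert x (set zs) \<Longrightarrow> v \<in> insert y (set zs) \<Longrightarrow> b v u = cnj (a u v)"
  shows "cnj (path_prod a (a x) zs y) = path_prod b (b y) (rev zs) x"
  using assms
proof (induction zs arbitrary: x)
  case (Cons z zs)
  have "cnj (path_prod a (a z) zs y) = path_prod b (b y) (rev zs) z"
    by (rule Cons.IH) (use Cons.prems in auto)
  with Cons.prems show ?case by (simp add: cnj_mult path_prod_append)
qed simp

section \<open>Row determinants of Hermitian matrices\<close>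

definition hermitian_on :: "('i \<Rightarrow> 'i \<Rightarrow> 'a) \<Rightarrow> 'i set \<Rightarrow> bool" where
  "hermitian_on a T \<longleftrightarrow> (\<forall>u\<in>T. \<forall>v\<in>T. a v u = cnj (a u v))"

lemma row_expansion_in_Reals:
  assumes "hermitian_on a T" "i \<in> T" "\<forall>U\<subset>T. real_row_independent a U"
  shows "row_expansion a (a i) T i \<in> \<real>"
proof (rule Reals_if_cnj_eq)
  have "cnj (row_expansion a (a i) T i) = (\<Sum>xs\<in>distinct_lists (T - {i}).
      (- 1) ^ length (rev xs) *\<^sub>R
        (path_prod a (a i) (rev xs) i * rdet_on a (T - set (i # rev xs))))"
    unfolding row_expansion_def cnj_sum
  proof (intro sum.cong refl)
    fix xs assume "xs \<in> distinct_lists (T - {i})"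
    then have "cnj (path_prod a (a i) xs i) = path_prod a (a i) (rev xs) i"
      using assms(1,2) by (intro cnj_path_prod) (auto simp: distinct_lists_def hermitian_on_def)
    moreover have "rdet_on a (T - set (i # xs)) \<in> \<real>"
      using assms(2,3) by (rule rdet_on_minor_in_Reals)
    ultimately show "cnj ((- 1) ^ length xs *\<^sub>R
          (path_prod a (a i) xs i * rdet_on a (T - set (i # xs)))) =
        (- 1) ^ length (rev xs) *\<^sub>R
          (path_prod a (a i) (rev xs) i * rdet_on a (T - set (i # rev xs)))"
      by (simp add: cnj_scaleR cnj_mult cnj_Reals Reals_commute)
  qed
  also have "\<dots> = row_expansion a (a i) T i"
    unfolding row_expansion_def by (rule sum_rev_distinct_lists)
  finally show "cnj (row_expansion a (a i) T i) = row_expansion a (a i) T i" .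
qed

lemma reduced_trace_row_expansion:
  assumes "finite T" "i \<in> T" "j \<in> T" "i \<noteq> j"
    and minors: "\<forall>U\<subset>T. real_row_independent a U"
  shows "reduced_trace (row_expansion a (a i) T i) =
    (\<Sum>(xs, ys)\<in>distinct_list_pairs (T - {i, j}). (- 1) ^ (length xs + length ys) *\<^sub>R
      ((reduced_trace (path_prod a (a j) xs j * path_prod a (a i) ys i) -
        reduced_trace (path_prod a (a i) xs j * path_prod a (a j) ys i)) *
        rdet_on a (T - set (i # j # xs @ ys))))"
  unfolding row_expansion_split[OF assms]
  by (simp only: reduced_trace_sum case_prod_unfold reduced_trace_scaleR reduced_trace_diff
      reduced_trace_mult_Reals[OF rdet_on_minor_in_Reals[OF assms(2) minors]])

lemma row_expansion_row_indep:
  assumes "finite T" "hermitian_on a T" "i \<in> T" "j \<in> T"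
    and minors: "\<forall>U\<subset>T. real_row_independent a U"
  shows "row_expansion a (a i) T i = row_expansion a (a j) T j"
proof (cases "i = j")
  case False
  let ?p = "\<lambda>k xs l. path_prod a (a k) xs l"
  have swap: "T - {j, i} = T - {i, j}" by auto
  have "reduced_trace (row_expansion a (a i) T i) = reduced_trace (row_expansion a (a j) T j)"
    unfolding reduced_trace_row_expansion[OF assms(1,3,4) False minors]
      reduced_trace_row_expansion[OF assms(1,4,3) False[symmetric] minors] swap
  proof (subst sum_distinct_list_pairs_swap, intro sum.cong refl, clarify)
    fix xs ys
    have "T - set (i # j # ys @ xs) = T - set (j # i # xs @ ys)" by auto
    then show "(- 1) ^ (length ys + length xs) *\<^sub>R
        ((reduced_trace (?p j ys j * ?p i xs i) - reduced_trace (?p i ys j * ?p j xs i)) *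
          rdet_on a (T - set (i # j # ys @ xs))) =
      (- 1) ^ (length xs + length ys) *\<^sub>R
        ((reduced_trace (?p i xs i * ?p j ys j) - reduced_trace (?p j xs i * ?p i ys j)) *
          rdet_on a (T - set (j # i # xs @ ys)))"
      by (simp only: add.commute[of "length ys"] reduced_trace_mult_commute[of "?p j ys j"]
          reduced_trace_mult_commute[of "?p i ys j"])
  qed
  moreover have "reduced_trace (row_expansion a (a k) T k) = 2 *\<^sub>R row_expansion a (a k) T k"
    if "k \<in> T" for k
    by (intro reduced_trace_eq_double cnj_Reals row_expansion_in_Reals assms(2) that minors)
  ultimately show ?thesis using assms(3,4) by simp
qed simp

lemma hermitian_on_imp_real_row_independent:
  assumes "finite T" "hermitian_on a T"
  shows "real_row_independent a T"
  using assms
proof (induction T rule: finite_psubset_induct)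
  case (psubset T)
  have minors: "\<forall>U\<subset>T. real_row_independent a U"
    using psubset.IH psubset.prems by (auto simp: hermitian_on_def)
  show ?case
  proof (cases "T = {}")
    case False
    then have "Min T \<in> T" using \<open>finite T\<close> by simp
    moreover have "row_expansion a (a i) T i = row_expansion a (a (Min T)) T (Min T)"
      if "i \<in> T" for i
      by (rule row_expansion_row_indep[OF \<open>finite T\<close> psubset.prems that \<open>Min T \<in> T\<close> minors])
    ultimately show ?thesis
      unfolding real_row_independent_def rdet_on_eq_row_expansion_Min[OF \<open>finite T\<close> False]
      using row_expansion_in_Reals[OF psubset.prems _ minors] by blast
  qed (simp add: real_row_independent_def)
qed

lemma row_expansion_hermitian:
  assumes "finite T" "hermitian_on a T" "i \<in> T" "k \<in> T"
  shows "row_expansion a (a k) T i = (if k = i then rdet_on a T else 0)"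
proof -
  have "real_row_independent a U" if "U \<subseteq> T" for U
    using that assms(1,2)
    by (intro hermitian_on_imp_real_row_independent)
      (auto simp: hermitian_on_def intro: finite_subset)
  then show ?thesis
    using assms row_expansion_other_row_eq_0[of T i k a] by (auto simp: real_row_independent_def)
qed

end

section \<open>Coquaternionic matrices\<close>

interpretation coquat: real_conjugation cq_cnj
proof
  fix p :: coquat
  assume "cq_cnj p = p"
  then have "p = of_real (cq0 p)"
    by (cases p) (simp add: cq_cnj_def of_real_def one_coquat_def scaleR_coquat_def)
  then show "p \<in> \<real>" by (metis Reals_of_real)
qed (simp_all add: cq_cnj_def plus_coquat_def times_coquat_def scaleR_coquat_def algebra_simps)

abbreviation (input) mat_entry :: "'a mat \<Rightarrow> nat \<Rightarrow> nat \<Rightarrow> 'a" where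
  "mat_entry A \<equiv> \<lambda>i j. A $$ (i, j)"

lemma minus_one_power_mult: "(- 1) ^ k * (p :: 'a :: real_algebra_1) = (- 1) ^ k *\<^sub>R p"
  by (simp add: scaleR_conv_of_real)

lemma cycle_prod_eq_cycle_weight:
  assumes "permutation \<sigma>"
  shows "cycle_prod A \<sigma> s = cycle_weight (mat_entry A) \<sigma> s"
proof -
  define n where "n = least_power \<sigma> s"
  have n: "0 < n" "(\<sigma> ^^ n) s = s"
    unfolding n_def using least_power_of_permutation[OF assms] by blast+
  have "cycle_tail \<sigma> s = map (\<lambda>t. (\<sigma> ^^ t) s) [Suc 0..<n]"
    by (simp add: cycle_tail_def n_def map_tl[symmetric])
  then have "cycle_weight (mat_entry A) \<sigma> s =
      prod_list (map (\<lambda>t. A $$ ((\<sigma> ^^ t) s, (\<sigma> ^^ Suc t) s)) [0..<n])"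
    using path_prod_map_upt[OF n(1), of "mat_entry A" "\<lambda>t. (\<sigma> ^^ t) s"]
    by (simp add: cycle_weight_def n(2))
  then show ?thesis
    by (simp add: cycle_prod_def n_def least_power_eq_card_orbit[OF assms])
qed

lemma rdet_eq_row_expansion:
  assumes "A \<in> carrier_mat n n" "i < n"
  shows "rdet i A = row_expansion (mat_entry A) (mat_entry A i) {0..<n} i"
proof -
  let ?T = "{0..<n}"
  have "rdet i A = (\<Sum>\<sigma> | \<sigma> permutes ?T. signed_cycle_prod (mat_entry A) ?T \<sigma>
      (i # sorted_list_of_set (Min ` (orbit \<sigma> ` ?T - {orbit \<sigma> i}))))"
    using assms(1)
    unfolding rdet_def Let_def perm_cycles_def cycle_starts_def minus_one_power_mult
      signed_cycle_prod_def
    by (intro sum.cong arg_cong2[of _ _ _ _ "(*\<^sub>R)"] arg_cong[of _ _ prod_list] map_cong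
        cycle_prod_eq_cycle_weight) (auto simp: permutation_permutes)
  also have "\<dots> = row_expansion (mat_entry A) (mat_entry A i) ?T i"
    using assms(2) by (intro sum_signed_cycle_prod_eq_row_expansion) simp_all
  finally show ?thesis .
qed

subsection \<open>Adjoints\<close>

lemma cq_adjoint_carrier: "A \<in> carrier_mat m n \<Longrightarrow> cq_adjoint A \<in> carrier_mat n m"
  by (simp add: cq_adjoint_def)

lemma cq_adjoint_index:
  "A \<in> carrier_mat m n \<Longrightarrow> i < n \<Longrightarrow> j < m \<Longrightarrow> cq_adjoint A $$ (i, j) = cq_cnj (A $$ (j, i))"
  by (simp add: cq_adjoint_def)

lemma cq_adjoint_adjoint: "cq_adjoint (cq_adjoint A) = A"
  by (rule eq_matI) (simp_all add: cq_adjoint_def)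

lemma cq_adjoint_one: "cq_adjoint (1\<^sub>m n) = 1\<^sub>m n"
  by (rule eq_matI) (auto simp: cq_adjoint_def coquat.cnj_one coquat.cnj_zero)

lemma cq_adjoint_mult:
  assumes "A \<in> carrier_mat m n" "B \<in> carrier_mat n p"
  shows "cq_adjoint (A * B) = cq_adjoint B * cq_adjoint A"
  using assms
  by (intro eq_matI)
    (auto simp: cq_adjoint_def scalar_prod_def coquat.cnj_sum coquat.cnj_mult)

lemma cq_adjoint_replace_row:
  assumes "A \<in> carrier_mat n n" "b \<in> carrier_vec n"
  shows "cq_adjoint (replace_row A b i) = replace_col (cq_adjoint A) (map_vec cq_cnj b) i"
  using assms by (intro eq_matI) (auto simp: cq_adjoint_def replace_row_def replace_col_def)

lemma cycle_prod_adjoint_inv: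
  assumes "A \<in> carrier_mat n n" "\<sigma> permutes {0..<n}" "s < n"
  shows "cycle_prod (cq_adjoint A) (Hilbert_Choice.inv \<sigma>) s = cq_cnj (cycle_prod A \<sigma> s)"
proof -
  have \<sigma>: "permutation \<sigma>" using assms(2) permutation_permutes by blast
  have "set (s # cycle_tail \<sigma> s) \<subseteq> {0..<n}"
    unfolding set_cycle_tail[OF \<sigma>] using permutes_orbit_subset[OF assms(2)] assms(3) by simp
  then have "cq_cnj (cycle_weight (mat_entry A) \<sigma> s) =
      path_prod (mat_entry (cq_adjoint A)) (mat_entry (cq_adjoint A) s) (rev (cycle_tail \<sigma> s)) s"
    unfolding cycle_weight_def
    by (intro coquat.cnj_path_prod cq_adjoint_index[OF assms(1)]) auto
  then show ?thesis
    by (simp add: cycle_prod_eq_cycle_weight \<sigma> permutation_inverse cycle_weight_def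
        cycle_tail_inv)
qed

lemma cdet_adjoint:
  assumes "A \<in> carrier_mat n n" "i < n"
  shows "cdet i (cq_adjoint A) = cq_cnj (rdet i A)"
proof -
  have summand: "cq_cnj ((- 1) ^ (n - card (perm_cycles n \<sigma>)) *
        prod_list (map (cycle_prod A \<sigma>) (cycle_starts n i \<sigma>))) =
      (- 1) ^ (n - card (perm_cycles n (Hilbert_Choice.inv \<sigma>))) *
        prod_list (map (cycle_prod (cq_adjoint A) (Hilbert_Choice.inv \<sigma>))
          (rev (cycle_starts n i (Hilbert_Choice.inv \<sigma>))))"
    if "\<sigma> permutes {0..<n}" for \<sigma>
  proof -
    have \<sigma>: "permutation \<sigma>" using that permutation_permutes by blast
    have orbits: "orbit (Hilbert_Choice.inv \<sigma>) = orbit \<sigma>"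
      using orbit_inv_eq[OF \<sigma>] by blast
    have cycles: "perm_cycles n (Hilbert_Choice.inv \<sigma>) = perm_cycles n \<sigma>"
      "cycle_starts n i (Hilbert_Choice.inv \<sigma>) = cycle_starts n i \<sigma>"
      by (simp_all add: perm_cycles_def cycle_starts_def orbits)
    have "set (cycle_starts n i \<sigma>) \<subseteq> {0..<n}"
      using assms(2) Min_orbit_in[OF \<sigma>] permutes_orbit_subset[OF that]
      by (fastforce simp: cycle_starts_def perm_cycles_def)
    then have "map (cq_cnj \<circ> cycle_prod A \<sigma>) (rev (cycle_starts n i \<sigma>)) =
        map (cycle_prod (cq_adjoint A) (Hilbert_Choice.inv \<sigma>)) (rev (cycle_starts n i \<sigma>))"
      by (intro map_cong refl) (auto simp: cycle_prod_adjoint_inv[OF assms(1) that])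
    then show ?thesis
      by (simp only: minus_one_power_mult coquat.cnj_scaleR coquat.cnj_prod_list rev_map map_map
          cycles)
  qed
  have "cq_cnj (rdet i A) = (\<Sum>\<sigma> | \<sigma> permutes {0..<n}.
      (- 1) ^ (n - card (perm_cycles n (Hilbert_Choice.inv \<sigma>))) *
        prod_list (map (cycle_prod (cq_adjoint A) (Hilbert_Choice.inv \<sigma>))
          (rev (cycle_starts n i (Hilbert_Choice.inv \<sigma>)))))"
    using assms(1) by (simp add: rdet_def Let_def coquat.cnj_sum summand)
  also have "\<dots> = cdet i (cq_adjoint A)"
    using cq_adjoint_carrier[OF assms(1)]
    unfolding cdet_def Let_def by (subst sum_permutations_inverse) simp
  finally show ?thesis ..
qed

subsection \<open>Replacing a row or a column\<close>

lemma replace_row_carrier: "A \<in> carrier_mat m n \<Longrightarrow> replace_row A b i \<in> carrier_mat m n"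
  by (simp add: replace_row_def)

lemma rdet_replace_row:
  assumes "A \<in> carrier_mat n n" "i < n"
  shows "rdet i (replace_row A b i) = row_expansion (mat_entry A) (($) b) {0..<n} i"
proof -
  have entry: "replace_row A b i $$ (u, v) = (if u = i then b $ v else A $$ (u, v))"
    if "u < n" "v < n" for u v
    using assms(1) that by (simp add: replace_row_def)
  show ?thesis
    unfolding rdet_eq_row_expansion[OF replace_row_carrier[OF assms(1)] assms(2)]
  proof (rule row_expansion_cong)
    fix U assume "U \<subseteq> {0..<n} - {i}"
    then have "finite U" "\<And>u. u \<in> U \<Longrightarrow> u < n \<and> u \<noteq> i" by (auto intro: finite_subset)
    then show "rdet_on (mat_entry (replace_row A b i)) U = rdet_on (mat_entry A) U"
      by (intro rdet_on_cong) (simp_all add: entry)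
  qed (use assms(2) in \<open>auto simp: entry\<close>)
qed

lemma rdet_replace_row_eq_sum_unit_vec:
  assumes "A \<in> carrier_mat n n" "i < n"
  shows "rdet i (replace_row A b i) = (\<Sum>j<n. b $ j * rdet i (replace_row A (unit_vec n j) i))"
proof -
  have "rdet i (replace_row A (unit_vec n j) i) =
      row_expansion (mat_entry A) (\<lambda>l. if l = j then 1 else 0) {0..<n} i" if "j < n" for j
    unfolding rdet_replace_row[OF assms]
    using assms(2) that by (intro row_expansion_cong) auto
  then show ?thesis
    using assms row_expansion_eq_sum_unit[of "{0..<n}" i "mat_entry A" "($) b"]
    by (simp add: rdet_replace_row atLeast0LessThan)
qed

lemma rdet_replace_row_smult:
  assumes "A \<in> carrier_mat n n" "i < n" "b \<in> carrier_vec n"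
  shows "rdet i (replace_row A (p \<cdot>\<^sub>v b) i) = p * rdet i (replace_row A b i)"
  using assms
  by (simp add: rdet_replace_row_eq_sum_unit_vec[of _ n] sum_distrib_left mult.assoc)

lemma cdet_replace_col:
  assumes "A \<in> carrier_mat n n" "i < n" "b \<in> carrier_vec n"
  shows "cdet i (replace_col A b i) =
    cq_cnj (rdet i (replace_row (cq_adjoint A) (map_vec cq_cnj b) i))"
proof -
  have "map_vec cq_cnj (map_vec cq_cnj b) = b"
    by (rule eq_vecI) simp_all
  then have "replace_col A b i = cq_adjoint (replace_row (cq_adjoint A) (map_vec cq_cnj b) i)"
    using assms
    by (subst cq_adjoint_replace_row[of _ n])
      (auto simp: cq_adjoint_carrier cq_adjoint_adjoint)
  then show ?thesis
    using assms by (simp add: cdet_adjoint[of _ n] replace_row_carrier cq_adjoint_carrier)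
qed

lemma cdet_replace_col_smult:
  assumes "A \<in> carrier_mat n n" "i < n" "b \<in> carrier_vec n" "p \<in> \<real>"
  shows "cdet i (replace_col A (p \<cdot>\<^sub>v b) i) = p * cdet i (replace_col A b i)"
proof -
  have "map_vec cq_cnj (p \<cdot>\<^sub>v b) = p \<cdot>\<^sub>v map_vec cq_cnj b"
    by (rule eq_vecI)
      (simp_all add: coquat.cnj_mult coquat.cnj_Reals[OF assms(4)] Reals_commute[OF assms(4)])
  then show ?thesis
    using assms
    by (simp add: cdet_replace_col[of _ n] rdet_replace_row_smult[of _ n] cq_adjoint_carrier
        coquat.cnj_mult coquat.cnj_Reals Reals_commute[OF assms(4)])
qed

subsection \<open>Hermitian matrices and their inverses\<close>

lemma hermitian_on_mat_entry:
  assumes "A \<in> carrier_mat n n" "cq_hermitian A"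
  shows "coquat.hermitian_on (mat_entry A) {0..<n}"
proof -
  have "cq_adjoint A = A" using assms(2) by (simp add: cq_hermitian_def)
  then show ?thesis
    unfolding coquat.hermitian_on_def
    using cq_adjoint_index[OF assms(1)] by (metis atLeastLessThan_iff)
qed

lemma of_real_hdet:
  assumes "A \<in> carrier_mat n n" "cq_hermitian A" "0 < n"
  shows "of_real (hdet A) = rdet_on (mat_entry A) {0..<n}"
proof -
  note herm = hermitian_on_mat_entry[OF assms(1,2)]
  have "rdet_on (mat_entry A) {0..<n} \<in> \<real>"
    using coquat.hermitian_on_imp_real_row_independent[OF _ herm]
    by (simp add: real_row_independent_def)
  then obtain d where d: "rdet_on (mat_entry A) {0..<n} = of_real d" by (rule Reals_cases)
  have rdet: "rdet i A = of_real d" if "i < n" for i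
    using coquat.row_expansion_hermitian[OF _ herm] that
    by (simp add: rdet_eq_row_expansion[OF assms(1)] d)
  moreover have "cdet i A = of_real d" if "i < n" for i
    using cdet_adjoint[OF assms(1) that] rdet[OF that] assms(2)
    by (simp add: cq_hermitian_def coquat.cnj_Reals)
  ultimately have "hdet A = d"
    unfolding hdet_def using assms(1,3) by (intro the_equality) auto
  then show ?thesis by (simp add: d)
qed

lemma rdet_replace_row_hermitian:
  assumes "A \<in> carrier_mat n n" "cq_hermitian A" "i < n" "k < n"
  shows "rdet i (replace_row A (row A k) i) = (if k = i then of_real (hdet A) else 0)"
proof -
  have "rdet i (replace_row A (row A k) i) =
      row_expansion (mat_entry A) (mat_entry A k) {0..<n} i"
    unfolding rdet_replace_row[OF assms(1,3)]
    using assms by (intro row_expansion_cong) auto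
  then show ?thesis
    using coquat.row_expansion_hermitian[OF _ hermitian_on_mat_entry[OF assms(1,2)], of i k]
      of_real_hdet[OF assms(1,2)] assms(3,4) by simp
qed

definition hermitian_inverse :: "coquat mat \<Rightarrow> coquat mat" where
  "hermitian_inverse A = mat (dim_row A) (dim_row A)
     (\<lambda>(j, i). rdet i (replace_row A (unit_vec (dim_row A) j) i) /\<^sub>R hdet A)"

lemma hermitian_inverse_carrier:
  "A \<in> carrier_mat n n \<Longrightarrow> hermitian_inverse A \<in> carrier_mat n n"
  by (simp add: hermitian_inverse_def)

lemma mult_hermitian_inverse_index:
  assumes "A \<in> carrier_mat n n" "M \<in> carrier_mat m n" "l < m" "i < n"
  shows "(M * hermitian_inverse A) $$ (l, i) = rdet i (replace_row A (row M l) i) /\<^sub>R hdet A"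
  using assms
  by (simp add: rdet_replace_row_eq_sum_unit_vec[OF assms(1,4), of "row M l"]
      hermitian_inverse_def scalar_prod_def scaleR_sum_right atLeast0LessThan)

context
  fixes A :: "coquat mat" and n :: nat
  assumes A: "A \<in> carrier_mat n n" "cq_hermitian A" and hdet: "hdet A \<noteq> 0"
begin

lemma mult_hermitian_inverse: "A * hermitian_inverse A = 1\<^sub>m n"
proof (rule eq_matI)
  fix k i assume "k < dim_row (1\<^sub>m n :: coquat mat)" "i < dim_col (1\<^sub>m n :: coquat mat)"
  then have "k < n" "i < n" by simp_all
  then show "(A * hermitian_inverse A) $$ (k, i) = 1\<^sub>m n $$ (k, i)"
    using hdet
    by (simp add: mult_hermitian_inverse_index[OF A(1,1)] rdet_replace_row_hermitian[OF A]
        of_real_def)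
qed (use A hermitian_inverse_carrier[OF A(1)] in auto)

lemma cq_adjoint_hermitian_inverse: "cq_adjoint (hermitian_inverse A) = hermitian_inverse A"
proof -
  let ?R = "hermitian_inverse A"
  note R = hermitian_inverse_carrier[OF A(1)]
  have left: "cq_adjoint ?R * A = 1\<^sub>m n"
    using cq_adjoint_mult[OF A(1) R] A(2)
    by (simp add: mult_hermitian_inverse cq_adjoint_one cq_hermitian_def)
  have "cq_adjoint ?R = cq_adjoint ?R * (A * ?R)"
    using cq_adjoint_carrier[OF R] by (simp add: mult_hermitian_inverse)
  also have "\<dots> = cq_adjoint ?R * A * ?R"
    by (rule assoc_mult_mat[symmetric, OF cq_adjoint_carrier[OF R] A(1) R])
  finally show ?thesis using R by (simp add: left)
qed

lemma hermitian_inverse_mult: "hermitian_inverse A * A = 1\<^sub>m n"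
  using cq_adjoint_mult[OF A(1) hermitian_inverse_carrier[OF A(1)]] A(2)
  by (simp add: mult_hermitian_inverse cq_adjoint_one cq_adjoint_hermitian_inverse cq_hermitian_def)

lemma hermitian_inverse_mult_index:
  assumes "M \<in> carrier_mat n m" "i < n" "l < m"
  shows "(hermitian_inverse A * M) $$ (i, l) = cdet i (replace_col A (col M l) i) /\<^sub>R hdet A"
proof -
  let ?R = "hermitian_inverse A"
  note R = hermitian_inverse_carrier[OF A(1)] and M' = cq_adjoint_carrier[OF assms(1)]
  have "row (cq_adjoint M) l = map_vec cq_cnj (col M l)"
    using assms by (auto simp: cq_adjoint_def)
  then have "cdet i (replace_col A (col M l) i) /\<^sub>R hdet A = cq_cnj ((cq_adjoint M * ?R) $$ (l, i))"
    using A(2) assms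
    by (simp add: mult_hermitian_inverse_index[OF A(1) M'] cdet_replace_col[OF A(1)]
        cq_hermitian_def coquat.cnj_scaleR)
  also have "\<dots> = cq_adjoint (cq_adjoint M * ?R) $$ (i, l)"
    using mult_carrier_mat[OF M' R] assms by (simp add: cq_adjoint_index)
  also have "cq_adjoint (cq_adjoint M * ?R) = ?R * M"
    by (simp add: cq_adjoint_mult[OF M' R] cq_adjoint_adjoint cq_adjoint_hermitian_inverse)
  finally show ?thesis ..
qed

end

section \<open>Two-sided matrix equations\<close>

lemma mult_mult_eq_iff_inverses:
  fixes A B C :: "'a :: semiring_1 mat"
  assumes "A \<in> carrier_mat m m" "A' \<in> carrier_mat m m" "A' * A = 1\<^sub>m m" "A * A' = 1\<^sub>m m"
    and "B \<in> carrier_mat n n" "B' \<in> carrier_mat n n" "B * B' = 1\<^sub>m n" "B' * B = 1\<^sub>m n"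
    and "C \<in> carrier_mat m n" "X \<in> carrier_mat m n"
  shows "A * X * B = C \<longleftrightarrow> X = A' * C * B'"
proof -
  have cancel: "P' * (P * Y * Q) * Q' = Y"
    if "P \<in> carrier_mat m m" "P' \<in> carrier_mat m m" "P' * P = 1\<^sub>m m"
      "Q \<in> carrier_mat n n" "Q' \<in> carrier_mat n n" "Q * Q' = 1\<^sub>m n" "Y \<in> carrier_mat m n"
    for P P' Q Q' Y :: "'a mat"
  proof -
    have "P' * (P * Y * Q) * Q' = P' * (P * (Y * (Q * Q')))"
      using that(1,2,4,5,7) by (simp add: assoc_mult_mat[of _ _ _ _ n])
    also have "\<dots> = P' * (P * Y)"
      using that(6,7) by simp
    also have "\<dots> = P' * P * Y"
      by (rule assoc_mult_mat[symmetric, OF that(2,1,7)])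
    finally show ?thesis using that(3,7) by simp
  qed
  show ?thesis
  proof
    show "X = A' * C * B'" if "A * X * B = C"
      unfolding that[symmetric] by (rule cancel[OF assms(1-3,5-7,10), symmetric])
    show "A * X * B = C" if "X = A' * C * B'"
      unfolding that by (rule cancel[OF assms(2,1,4,6,5,8,9)])
  qed
qed

context
  fixes A B C :: "coquat mat" and m n i j :: nat
  assumes A: "A \<in> carrier_mat m m" "cq_hermitian A" "hdet A \<noteq> 0"
    and B: "B \<in> carrier_mat n n" "cq_hermitian B" "hdet B \<noteq> 0"
    and C: "C \<in> carrier_mat m n" and ij: "i < m" "j < n"
begin

lemma hermitian_solution_index_rdet:
  "(hermitian_inverse A * C * hermitian_inverse B) $$ (i, j) =
    rdet j (replace_row B (vec n (\<lambda>l. cdet i (replace_col A (col C l) i))) j)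
      /\<^sub>R (hdet A * hdet B)"
proof -
  let ?c = "vec n (\<lambda>l. cdet i (replace_col A (col C l) i))"
  note AC = mult_carrier_mat[OF hermitian_inverse_carrier[OF A(1)] C]
  have "row (hermitian_inverse A * C) i = of_real (inverse (hdet A)) \<cdot>\<^sub>v ?c"
  proof (rule eq_vecI)
    fix l assume "l < dim_vec (of_real (inverse (hdet A)) \<cdot>\<^sub>v ?c)"
    then have "l < n" by simp
    then show "row (hermitian_inverse A * C) i $ l = (of_real (inverse (hdet A)) \<cdot>\<^sub>v ?c) $ l"
      using hermitian_inverse_carrier[OF A(1)] C ij(1)
      by (simp add: hermitian_inverse_mult_index[OF A C ij(1)] scaleR_conv_of_real
          del: index_mult_mat(1) row_mult)
  qed (use C in simp)
  then show ?thesis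
    using mult_hermitian_inverse_index[OF B(1) AC ij]
    by (simp add: rdet_replace_row_smult[OF B(1) ij(2)] scaleR_conv_of_real[symmetric] mult.commute)
qed

lemma hermitian_solution_index_cdet:
  "(hermitian_inverse A * C * hermitian_inverse B) $$ (i, j) =
    cdet i (replace_col A (vec m (\<lambda>l. rdet j (replace_row B (row C l) j))) i)
      /\<^sub>R (hdet A * hdet B)"
proof -
  let ?c = "vec m (\<lambda>l. rdet j (replace_row B (row C l) j))"
  note inverse_B = hermitian_inverse_carrier[OF B(1)]
  note CB = mult_carrier_mat[OF C inverse_B]
  have "col (C * hermitian_inverse B) j = of_real (inverse (hdet B)) \<cdot>\<^sub>v ?c"
  proof (rule eq_vecI)
    fix l assume "l < dim_vec (of_real (inverse (hdet B)) \<cdot>\<^sub>v ?c)"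
    then have "l < m" by simp
    then show "col (C * hermitian_inverse B) j $ l = (of_real (inverse (hdet B)) \<cdot>\<^sub>v ?c) $ l"
      using inverse_B C ij(2)
      by (simp add: mult_hermitian_inverse_index[OF B(1) C _ ij(2)] scaleR_conv_of_real
          del: index_mult_mat(1) col_mult col_mult2)
  qed (use C in simp)
  then show ?thesis
    using hermitian_inverse_mult_index[OF A CB ij]
    by (simp add: assoc_mult_mat[OF hermitian_inverse_carrier[OF A(1)] C inverse_B]
        cdet_replace_col_smult[OF A(1) ij(1)] scaleR_conv_of_real[symmetric])
qed

end

theorem theorem5p1:
  fixes A B C :: "coquat mat" and m n :: nat
  assumes "m \<ge> 1" and "n \<ge> 1"
    and "A \<in> carrier_mat m m" and "B \<in> carrier_mat n n" and "C \<in> carrier_mat m n"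
    and "cq_hermitian A" and "cq_hermitian B"
    and "hdet A \<noteq> 0" and "hdet B \<noteq> 0"
  shows "(\<exists>!X. X \<in> carrier_mat m n \<and> A * X * B = C) \<and>
    (\<forall>X \<in> carrier_mat m n. A * X * B = C \<longrightarrow>
      (\<forall>i<m. \<forall>j<n.
        X $$ (i, j) =
          rdet j (replace_row B (vec n (\<lambda>l. cdet i (replace_col A (col C l) i))) j)
            /\<^sub>R (hdet A * hdet B) \<and>
        X $$ (i, j) =
          cdet i (replace_col A (vec m (\<lambda>l. rdet j (replace_row B (row C l) j))) i)
            /\<^sub>R (hdet A * hdet B)))"
proof -
  note A = \<open>A \<in> carrier_mat m m\<close> \<open>cq_hermitian A\<close> \<open>hdet A \<noteq> 0\<close>
    and B = \<open>B \<in> carrier_mat n n\<close> \<open>cq_hermitian B\<close> \<open>hdet B \<noteq> 0\<close>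
    and C = \<open>C \<in> carrier_mat m n\<close>
  note inverse_A = hermitian_inverse_carrier[OF A(1)] hermitian_inverse_mult[OF A]
      mult_hermitian_inverse[OF A]
    and inverse_B = hermitian_inverse_carrier[OF B(1)] mult_hermitian_inverse[OF B]
      hermitian_inverse_mult[OF B]
  let ?X = "hermitian_inverse A * C * hermitian_inverse B"
  have "?X \<in> carrier_mat m n" using inverse_A(1) inverse_B(1) C by simp
  moreover have solution: "A * X * B = C \<longleftrightarrow> X = ?X" if "X \<in> carrier_mat m n" for X
    by (rule mult_mult_eq_iff_inverses[OF A(1) inverse_A B(1) inverse_B C that])
  ultimately have unique: "\<exists>!X. X \<in> carrier_mat m n \<and> A * X * B = C"
    by blast
  show ?thesis
  proof (intro conjI[OF unique] ballI impI allI, goal_cases)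
    case entry: (1 X i j)
    then have "X = ?X" using solution by blast
    then show ?case
      using hermitian_solution_index_rdet[OF A B C entry(3,4)]
        hermitian_solution_index_cdet[OF A B C entry(3,4)] by blast
  qed
qed

end
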